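(* Let $x^*$ be an optimal solution of the assortment problem under a mixture of CNL models (MA) and let $\widehat x$ be (the $x$-part of) an optimal solution of its approximation (MA-LFP), both described in the context, where the interpolants used have maximum relative errors at most $\epsilon\in(0,1)$. Then $$\frac{1-\epsilon}{1+\epsilon}F(x^* )\le F(\widehat x)\le F(x^* ).$$
   Context: Setting: $m$ products, $N$ nests $S_1=\dots=S_N=[m]$, $T$ customer types with probabilities $\theta_t\ge0$, $\sum_{t\in[T]}\theta_t=1$. Revenues $r_i\ge0$; preference weights $v_{ti}\ge0$ of product $i$ for type $t$; allocation parameters $\alpha_{in}\ge0$ with $\sum_n\alpha_{in}=1$; no-purchase weights $v_{0n}\ge0$; dissimilarity parameters $\sigma_n\in[0,1]$; feasible set $X=\{x\in\{0,1\}^m:Ax\le b\}\ne\emptyset$. (MA): maximize over $x\in X$ $$F(x)=\sum_{t\in[T]}\theta_t\frac{\sum_{i\in[m]}\sum_{n\in[N]}W_{tn}^{\sigma_n-1}\alpha_{in}x_ir_iv_{ti}}{\sum_{n\in[N]}W_{tn}^{\sigma_n}},\qquad W_{tn}=v_{0n}+\sum_{i\in[m]}\alpha_{in}x_iv_{ti}.$$ Interpolants: let $L_{tn},U_{tn}$ be the minimum and maximum of $W_{tn}$ over $x\in X$, with $0<L_{tn}<U_{tn}$; $f^n(t)=t^{\sigma_n-1}$, $g^n(t)=t^{\sigma_n}$. For each type $t$ and nest $n$, partition $[L_{tn},U_{tn}]$ by $L_{tn}=c^{tn}_1<\dots<c^{tn}_{K_{tn}+1}=U_{tn}$, and let $\widehat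 f^{tn},\widehat g^{tn}$ be the continuous piecewise affine interpolants of $f^n,g^n$ on $[L_{tn},U_{tn}]$ at these points. "Maximum relative errors at most $\epsilon$" means $\max_w(\widehat f^{tn}(w)-f^n(w))/f^n(w)\le\epsilon$ and $\max_w(g^n(w)-\widehat g^{tn}(w))/g^n(w)\le\epsilon$ over $w\in[L_{tn},U_{tn}]$, for all $t,n$. Let $\Delta_{tnk}=c^{tn}_{k+1}-c^{tn}_k$, $\gamma^{f}_{tnk}=(f^n(c^{tn}_{k+1})-f^n(c^{tn}_k))/\Delta_{tnk}$, $\gamma^{g}_{tnk}=(g^n(c^{tn}_{k+1})-g^n(c^{tn}_k))/\Delta_{tnk}$. (MA-LFP): with $a_{tin}=\alpha_{in}v_{ti}r_if^n(L_{tn})$, $b_{tink}=\alpha_{in}v_{ti}r_i\gamma^f_{tnk}\Delta_{tnk}$, $c_t=\sum_ng^n(L_{tn})$, $d_{tnk}=\Delta_{tnk}\gamma^g_{tnk}$, maximize over $x\in X$, $y_{tnk}\in\{0,1\}$, $z_{tnk}\in[0,1]$, $s_{tink}\in[0,1]$ $$\widehat F(x)=\sum_{t\in[T]}\theta_t\frac{\sum_{i,n}a_{tin}x_i+\sum_{i,n,k}b_{tink}s_{tink}}{c_t+\sum_{n,k}d_{tnk}z_{tnk}}$$ subject to, for all $t,n,i$: $v_{0n}+\sum_i\alpha_{in}x_iv_{ti}=L_{tn}+\sum_{k\in[K_{tn}]}\Delta_{tnk}z_{tnk}$; $y_{tn,k+1}\le y_{tnk}\le z_{tnk}$ and $z_{tn,k+1}\le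 y_{tnk}$ for $k\in[K_{tn}-1]$; $s_{tink}\le x_i$, $s_{tink}\le z_{tnk}$, $s_{tink}\ge x_i+z_{tnk}-1$ for $k\in[K_{tn}]$. *)

theory Defs
  imports "HOL-Analysis.Analysis"
begin

text \<open>
  Products, nests, customer types and the rows of the constraint system \<open>A x \<le> b\<close> are indexed by
  finite types \<open>'m\<close>, \<open>'n\<close>, \<open>'t\<close>, \<open>'p\<close>. Breakpoints are indexed by natural numbers from 1, since
  their number may differ between (type, nest) pairs.
\<close>

record ('m::finite, 'n::finite, 't::finite, 'p::finite) ma_instance =
  type_prob :: "'t \<Rightarrow> real"
  revenue :: "'m \<Rightarrow> real"
  pref :: "'t \<Rightarrow> 'm \<Rightarrow> real"
  alloc :: "'m \<Rightarrow> 'n \<Rightarrow> real"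
  nopurchase :: "'n \<Rightarrow> real"
  dissim :: "'n \<Rightarrow> real"
  con_mat :: "real ^ 'm ^ 'p"
  con_rhs :: "real ^ 'p"

text \<open>The order on \<^typ>\<open>real ^ 'p\<close> is componentwise.\<close>

definition assortments :: "('m::finite, 'n::finite, 't::finite, 'p::finite) ma_instance \<Rightarrow> (real ^ 'm) set" where
  "assortments P = {x. (\<forall>i. x $ i \<in> {0, 1}) \<and> con_mat P *v x \<le> con_rhs P}"

definition nest_weight ::
    "('m::finite, 'n::finite, 't::finite, 'p::finite) ma_instance \<Rightarrow> 't \<Rightarrow> 'n \<Rightarrow> real ^ 'm \<Rightarrow> real" where
  "nest_weight P t n x = nopurchase P n + (\<Sum>i\<in>UNIV. alloc P i n * x $ i * pref P t i)"

definition ma_revenue ::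
    "('m::finite, 'n::finite, 't::finite, 'p::finite) ma_instance \<Rightarrow> real ^ 'm \<Rightarrow> real" where
  "ma_revenue P x =
     (\<Sum>t\<in>UNIV. type_prob P t *
        ((\<Sum>i\<in>UNIV. \<Sum>n\<in>UNIV.
            nest_weight P t n x powr (dissim P n - 1) * alloc P i n * x $ i * revenue P i * pref P t i)
         / (\<Sum>n\<in>UNIV. nest_weight P t n x powr dissim P n)))"

definition weight_min ::
    "('m::finite, 'n::finite, 't::finite, 'p::finite) ma_instance \<Rightarrow> 't \<Rightarrow> 'n \<Rightarrow> real" where
  "weight_min P t n = Min (nest_weight P t n ` assortments P)"

definition weight_max ::
    "('m::finite, 'n::finite, 't::finite, 'p::finite) ma_instance \<Rightarrow> 't \<Rightarrow> 'n \<Rightarrow> real" where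
  "weight_max P t n = Max (nest_weight P t n ` assortments P)"

definition f_nest :: "('m::finite, 'n::finite, 't::finite, 'p::finite) ma_instance \<Rightarrow> 'n \<Rightarrow> real \<Rightarrow> real" where
  "f_nest P n w = w powr (dissim P n - 1)"

definition g_nest :: "('m::finite, 'n::finite, 't::finite, 'p::finite) ma_instance \<Rightarrow> 'n \<Rightarrow> real \<Rightarrow> real" where
  "g_nest P n w = w powr dissim P n"

definition is_partition :: "real \<Rightarrow> real \<Rightarrow> nat \<Rightarrow> (nat \<Rightarrow> real) \<Rightarrow> bool" where
  "is_partition lo hi K c \<longleftrightarrow> c 1 = lo \<and> c (K + 1) = hi \<and> (\<forall>k\<in>{1..K}. c k < c (k + 1))"

definition is_pwa_interpolant :: "(real \<Rightarrow> real) \<Rightarrow> nat \<Rightarrow> (nat \<Rightarrow> real) \<Rightarrow> (real \<Rightarrow> real) \<Rightarrow> bool" where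
  "is_pwa_interpolant h K c p \<longleftrightarrow>
     continuous_on {c 1..c (K + 1)} p \<and>
     (\<forall>k\<in>{1..K}. \<exists>a b. \<forall>w\<in>{c k..c (k + 1)}. p w = a * w + b) \<and>
     (\<forall>k\<in>{1..K + 1}. p (c k) = h (c k))"

text \<open>The supremum below is a maximum for continuous \<open>p\<close>, \<open>q\<close>, and \<open>h\<close> positive on \<open>[lo, hi]\<close>.\<close>

definition max_rel_diff :: "real \<Rightarrow> real \<Rightarrow> (real \<Rightarrow> real) \<Rightarrow> (real \<Rightarrow> real) \<Rightarrow> (real \<Rightarrow> real) \<Rightarrow> real" where
  "max_rel_diff lo hi p q h = (SUP w\<in>{lo..hi}. (p w - q w) / h w)"

definition slope :: "(real \<Rightarrow> real) \<Rightarrow> (nat \<Rightarrow> real) \<Rightarrow> nat \<Rightarrow> real" where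
  "slope h c k = (h (c (k + 1)) - h (c k)) / (c (k + 1) - c k)"

definition lfp_a ::
    "('m::finite, 'n::finite, 't::finite, 'p::finite) ma_instance \<Rightarrow> 't \<Rightarrow> 'm \<Rightarrow> 'n \<Rightarrow> real" where
  "lfp_a P t i n = alloc P i n * pref P t i * revenue P i * f_nest P n (weight_min P t n)"

definition lfp_b ::
    "('m::finite, 'n::finite, 't::finite, 'p::finite) ma_instance \<Rightarrow> ('t \<Rightarrow> 'n \<Rightarrow> nat \<Rightarrow> real) \<Rightarrow>
     't \<Rightarrow> 'm \<Rightarrow> 'n \<Rightarrow> nat \<Rightarrow> real" where
  "lfp_b P c t i n k =
     alloc P i n * pref P t i * revenue P i * slope (f_nest P n) (c t n) k * (c t n (k + 1) - c t n k)"

definition lfp_c :: "('m::finite, 'n::finite, 't::finite, 'p::finite) ma_instance \<Rightarrow> 't \<Rightarrow> real" where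
  "lfp_c P t = (\<Sum>n\<in>UNIV. g_nest P n (weight_min P t n))"

definition lfp_d ::
    "('m::finite, 'n::finite, 't::finite, 'p::finite) ma_instance \<Rightarrow> ('t \<Rightarrow> 'n \<Rightarrow> nat \<Rightarrow> real) \<Rightarrow>
     't \<Rightarrow> 'n \<Rightarrow> nat \<Rightarrow> real" where
  "lfp_d P c t n k = (c t n (k + 1) - c t n k) * slope (g_nest P n) (c t n) k"

text \<open>
  A solution of the linear fractional program is a tuple \<open>(x, y, z, s)\<close>. Components of \<open>y\<close>, \<open>z\<close>, \<open>s\<close>
  with piece index outside \<open>{1..K t n}\<close> are unconstrained and do not enter the objective.
\<close>

type_synonym ('m, 'n, 't) lfp_point =
  "(real ^ 'm) \<times> ('t \<Rightarrow> 'n \<Rightarrow> nat \<Rightarrow> real) \<times> ('t \<Rightarrow> 'n \<Rightarrow> nat \<Rightarrow> real) \<times> ('t \<Rightarrow> 'm \<Rightarrow> 'n \<Rightarrow> nat \<Rightarrow> real)"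

definition lfp_feasible ::
    "('m::finite, 'n::finite, 't::finite, 'p::finite) ma_instance \<Rightarrow>
     ('t \<Rightarrow> 'n \<Rightarrow> nat) \<Rightarrow> ('t \<Rightarrow> 'n \<Rightarrow> nat \<Rightarrow> real) \<Rightarrow> ('m, 'n, 't) lfp_point set" where
  "lfp_feasible P K c = {(x, y, z, s).
     x \<in> assortments P \<and>
     (\<forall>t n. \<forall>k\<in>{1..K t n}. y t n k \<in> {0, 1} \<and> z t n k \<in> {0..1} \<and> (\<forall>i. s t i n k \<in> {0..1})) \<and>
     (\<forall>t n. nest_weight P t n x =
              weight_min P t n + (\<Sum>k\<in>{1..K t n}. (c t n (k + 1) - c t n k) * z t n k)) \<and>
     (\<forall>t n. \<forall>k\<in>{1..K t n - 1}.
        y t n (k + 1) \<le> y t n k \<and> y t n k \<le> z t n k \<and> z t n (k + 1) \<le> y t n k) \<and>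
     (\<forall>t n i. \<forall>k\<in>{1..K t n}.
        s t i n k \<le> x $ i \<and> s t i n k \<le> z t n k \<and> s t i n k \<ge> x $ i + z t n k - 1)}"

definition lfp_objective ::
    "('m::finite, 'n::finite, 't::finite, 'p::finite) ma_instance \<Rightarrow>
     ('t \<Rightarrow> 'n \<Rightarrow> nat) \<Rightarrow> ('t \<Rightarrow> 'n \<Rightarrow> nat \<Rightarrow> real) \<Rightarrow> ('m, 'n, 't) lfp_point \<Rightarrow> real" where
  "lfp_objective P K c = (\<lambda>(x, y, z, s).
     \<Sum>t\<in>UNIV. type_prob P t *
       (((\<Sum>i\<in>UNIV. \<Sum>n\<in>UNIV. lfp_a P t i n * x $ i)
         + (\<Sum>i\<in>UNIV. \<Sum>n\<in>UNIV. \<Sum>k\<in>{1..K t n}. lfp_b P c t i n k * s t i n k))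
        / (lfp_c P t + (\<Sum>n\<in>UNIV. \<Sum>k\<in>{1..K t n}. lfp_d P c t n k * z t n k))))"

end

theory Submission
  imports Defs
begin

text \<open>
  On feasible points of the linear fractional program the \<open>z\<close>-variables fill the pieces from left to
  right and \<open>s\<close> equals the product of \<open>x\<close> and \<open>z\<close>, so its objective is the revenue function
  with the interpolants in place of \<open>f\<close> and \<open>g\<close>. As \<open>f\<close> is convex and \<open>g\<close> concave, the
  interpolants err on one side only, and the approximate revenue lies between \<open>F\<close> and
  \<open>(1 + \<epsilon>) / (1 - \<epsilon>) * F\<close>. Comparing at the two maximizers gives the bound.
\<close>

section \<open>Piecewise affine interpolation on a partition\<close>

lemma partition_mono:
  assumes "is_partition lo hi K c" and "1 \<le> i" "i \<le> j" "j \<le> K + 1"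
  shows "c i \<le> c j"
  using assms(3,4)
proof (induction j rule: dec_induct)
  case base
  then show ?case by simp
next
  case (step k)
  then have "c k < c (k + 1)"
    using assms(1,2) by (auto simp: is_partition_def)
  with step show ?case by simp
qed

lemma partition_piece:
  assumes "is_partition lo hi K c" and "lo < hi" and "w \<in> {lo..hi}"
  obtains k where "k \<in> {1..K}" "w \<in> {c k..c (k + 1)}"
proof -
  have c: "c 1 = lo" "c (K + 1) = hi"
    using assms(1) by (auto simp: is_partition_def)
  \<comment> \<open>Stated for every prefix of pieces so that induction applies: a point beyond the
    first \<open>j\<close> pieces must lie in the newly added one.\<close>
  have "\<exists>k\<in>{1..j}. w \<in> {c k..c (k + 1)}" if "1 \<le> j" "w \<le> c (j + 1)" for j
    using that
  proof (induction j rule: dec_induct)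
    case base
    then show ?case using assms(3) c by auto
  next
    case (step j)
    show ?case
    proof (cases "w \<le> c (j + 1)")
      case True
      then obtain k where "k \<in> {1..j}" "w \<in> {c k..c (k + 1)}"
        using step.IH by auto
      then show ?thesis by (intro bexI[of _ k]) auto
    next
      case False
      then show ?thesis using step.prems by (intro bexI[of _ "Suc j"]) auto
    qed
  qed
  \<comment> \<open>With \<open>K = 0\<close>, the first breakpoint would be both \<open>lo\<close>
    and \<open>hi\<close>.\<close>
  moreover have "1 \<le> K"
    using c assms(2) by (cases K) auto
  moreover have "w \<le> c (K + 1)"
    using assms(3) c by simp
  ultimately show ?thesis
    using that by blast
qed

text \<open>The values at the two distinct endpoints determine the affine coefficients, so the
  existential in \<open>is_pwa_interpolant\<close> becomes an explicit chord.\<close>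

lemma pwa_interpolant_on_piece:
  assumes "is_partition lo hi K c" and "is_pwa_interpolant h K c p"
    and k: "k \<in> {1..K}" and w: "w \<in> {c k..c (k + 1)}"
  shows "p w = h (c k) + slope h c k * (w - c k)"
proof -
  have lt: "c k < c (k + 1)"
    using assms(1) k by (auto simp: is_partition_def)
  obtain a b where ab: "\<And>w. w \<in> {c k..c (k + 1)} \<Longrightarrow> p w = a * w + b"
    using assms(2) k unfolding is_pwa_interpolant_def by metis
  have "p (c k) = h (c k)" "p (c (k + 1)) = h (c (k + 1))"
    using assms(2) k by (auto simp: is_pwa_interpolant_def)
  with ab[of "c k"] ab[of "c (k + 1)"] lt
  have h: "h (c k) = a * c k + b" "h (c (k + 1)) = a * c (k + 1) + b"
    by auto
  then have "slope h c k = a"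
    using lt by (simp add: slope_def field_simps)
  with ab[OF w] h show ?thesis
    by (simp add: algebra_simps)
qed

text \<open>Each summand is the increment of \<open>p\<close> across the filled portion of one
  piece, and these increments telescope. The filling condition makes the filled portions adjacent: a
  piece is entered only after the one before it is full.\<close>

lemma pwa_interpolant_filling:
  assumes part: "is_partition lo hi K c" and pwa: "is_pwa_interpolant h K c p"
    and z: "\<And>k. k \<in> {1..K} \<Longrightarrow> z k \<in> {0..1}"
    and fill: "\<And>k. k \<in> {1..K - 1} \<Longrightarrow> z k = 1 \<or> z (k + 1) = 0"
  shows "(\<Sum>k\<in>{1..K}. slope h c k * (c (k + 1) - c k) * z k)
       = p (lo + (\<Sum>k\<in>{1..K}. (c (k + 1) - c k) * z k)) - p lo"
proof -
  define T where "T j = lo + (\<Sum>k\<in>{1..j}. (c (k + 1) - c k) * z k)" for j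
  \<comment> \<open>The second conjunct is the invariant that carries the induction: the next piece
    either stays empty or is entered exactly at its left endpoint. Its guard \<open>j < K\<close>
    keeps the index of \<open>z\<close> within the pieces.\<close>
  have "(\<Sum>k\<in>{1..j}. slope h c k * (c (k + 1) - c k) * z k) = p (T j) - p lo
      \<and> (j < K \<longrightarrow> z (j + 1) = 0 \<or> T j = c (j + 1))" if "j \<le> K" for j
    using that
  proof (induction j)
    case 0
    then show ?case using part by (simp add: T_def is_partition_def)
  next
    case (Suc j)
    then have IH: "(\<Sum>k\<in>{1..j}. slope h c k * (c (k + 1) - c k) * z k) = p (T j) - p lo"
      and start: "z (j + 1) = 0 \<or> T j = c (j + 1)"
      and k: "j + 1 \<in> {1..K}" by auto
    let ?d = "c (j + 2) - c (j + 1)"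
    have T: "T (Suc j) = T j + ?d * z (j + 1)"
      by (simp add: T_def)
    have lt: "c (j + 1) < c (j + 2)"
      using part k by (auto simp: is_partition_def)
    have zj: "0 \<le> z (j + 1)" "z (j + 1) \<le> 1"
      using z[OF k] by auto
    have step: "slope h c (j + 1) * ?d * z (j + 1) = p (T (Suc j)) - p (T j)"
    proof (cases "z (j + 1) = 0")
      case True
      then show ?thesis using T by simp
    next
      case False
      then have Tj: "T j = c (j + 1)" using start by simp
      have "?d * z (j + 1) \<le> ?d * 1"
        using lt zj by (intro mult_left_mono) auto
      moreover have "0 \<le> ?d * z (j + 1)"
        using lt zj by simp
      ultimately have "T (Suc j) \<in> {c (j + 1)..c (j + 1 + 1)}" "T j \<in> {c (j + 1)..c (j + 1 + 1)}"
        using T Tj lt by (auto simp: algebra_simps)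
      then show ?thesis
        using pwa_interpolant_on_piece[OF part pwa k] T Tj by simp
    qed
    have "z (j + 1 + 1) = 0 \<or> T (Suc j) = c (j + 1 + 1)" if "Suc j < K"
    proof -
      have "z (j + 1) = 1 \<or> z (j + 1 + 1) = 0"
        using fill[of "j + 1"] that by simp
      then show ?thesis using start T by auto
    qed
    then show ?case using IH step by simp
  qed
  from this[of K] show ?thesis
    by (simp add: T_def)
qed

text \<open>On each piece the interpolant is a chord, and a convex function lies below its
  chords.\<close>

lemma convex_le_pwa_interpolant:
  assumes part: "is_partition lo hi K c" and pwa: "is_pwa_interpolant h K c p"
    and "lo < hi" and conv: "convex_on {lo..hi} h" and w: "w \<in> {lo..hi}"
  shows "h w \<le> p w"
proof -
  obtain k where k: "k \<in> {1..K}" and wk: "w \<in> {c k..c (k + 1)}"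
    using partition_piece[OF part \<open>lo < hi\<close> w] by blast
  have lt: "c k < c (k + 1)"
    using part k by (auto simp: is_partition_def)
  have "lo \<le> c k" "c (k + 1) \<le> hi"
    using partition_mono[OF part, of 1 k] partition_mono[OF part, of "k + 1" "K + 1"] part k
    by (auto simp: is_partition_def)
  then have conv': "convex_on {c k..c (k + 1)} h"
    by (intro convex_on_subset[OF conv]) auto
  \<comment> \<open>The barycentric coordinate of \<open>w\<close> in its piece, which turns the
    chord value into a convex combination of the endpoint values.\<close>
  define u where "u = (w - c k) / (c (k + 1) - c k)"
  have u: "0 \<le> u" "u \<le> 1" and wu: "w = (1 - u) *\<^sub>R c k + u *\<^sub>R c (k + 1)"
    using lt wk by (auto simp: u_def divide_simps) (simp add: algebra_simps)
  have "h w \<le> (1 - u) * h (c k) + u * h (c (k + 1))"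
    using convex_onD_Icc[OF conv' _ u] lt wu by simp
  also have "\<dots> = p w"
    unfolding pwa_interpolant_on_piece[OF part pwa k wk] slope_def u_def
    by (simp add: algebra_simps diff_divide_distrib)
  finally show ?thesis .
qed

text \<open>Reduces to the convex case, since \<open>- p\<close> interpolates \<open>- h\<close> at
  the same breakpoints.\<close>

lemma concave_ge_pwa_interpolant:
  assumes "is_partition lo hi K c" and "is_pwa_interpolant h K c p"
    and "lo < hi" and "concave_on {lo..hi} h" and "w \<in> {lo..hi}"
  shows "p w \<le> h w"
proof -
  have "\<exists>a b. \<forall>w\<in>{c k..c (k + 1)}. - p w = a * w + b" if k: "k \<in> {1..K}" for k
    using pwa_interpolant_on_piece[OF assms(1,2) k]
    by (intro exI[of _ "- slope h c k"] exI[of _ "slope h c k * c k - h (c k)"])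
      (simp add: algebra_simps)
  then have "is_pwa_interpolant (\<lambda>w. - h w) K c (\<lambda>w. - p w)"
    using assms(2) by (simp add: is_pwa_interpolant_def continuous_on_minus)
  then have "- h w \<le> - p w"
    using assms by (intro convex_le_pwa_interpolant[of lo hi K c]) (auto simp: concave_on_def)
  then show ?thesis by simp
qed

section \<open>Two-sided bounds for the interpolants of the power functions\<close>

lemma powr_has_second_derivative:
  fixes e w :: real
  assumes "0 < w"
  shows "((\<lambda>w. w powr e) has_real_derivative e * w powr (e - 1)) (at w)"
    and "((\<lambda>w. e * w powr (e - 1)) has_real_derivative e * (e - 1) * w powr (e - 2)) (at w)"
  using assms by (auto intro!: derivative_eq_intros simp: algebra_simps)

text \<open>The second derivative has the sign of \<open>e * (e - 1)\<close>, a product of two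
  nonpositive factors here. The exponent of \<open>f_nest\<close> is of this kind, as it lies in
  [-1, 0].\<close>

lemma powr_convex_nonpos:
  fixes e :: real
  assumes "e \<le> 0"
  shows "convex_on {0<..} (\<lambda>w. w powr e)"
  by (rule f''_ge0_imp_convex[where f' = "\<lambda>w. e * w powr (e - 1)"
        and f'' = "\<lambda>w. e * (e - 1) * w powr (e - 2)"])
    (use assms powr_has_second_derivative in \<open>auto simp: mult_nonpos_nonpos\<close>)

lemma powr_concave:
  fixes e :: real
  assumes "0 \<le> e" "e \<le> 1"
  shows "concave_on {0<..} (\<lambda>w. w powr e)"
  by (rule f''_le0_imp_concave[where f' = "\<lambda>w. e * w powr (e - 1)"
        and f'' = "\<lambda>w. e * (e - 1) * w powr (e - 2)"])
    (use assms powr_has_second_derivative in \<open>auto simp: mult_nonneg_nonpos mult_nonpos_nonneg\<close>)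

text \<open>A supremum of reals bounds its members only if the set is bounded above. This comes from
  continuity on the compact interval.\<close>

lemma max_rel_diff_bound:
  assumes "continuous_on {lo..hi} p" "continuous_on {lo..hi} q" "continuous_on {lo..hi} h"
    and pos: "\<And>w. w \<in> {lo..hi} \<Longrightarrow> 0 < h w"
    and "max_rel_diff lo hi p q h \<le> \<epsilon>" and w: "w \<in> {lo..hi}"
  shows "p w - q w \<le> \<epsilon> * h w"
proof -
  have "continuous_on {lo..hi} (\<lambda>w. (p w - q w) / h w)"
    using assms(1-3) pos by (intro continuous_intros) (auto simp: less_le)
  then have "bdd_above ((\<lambda>w. (p w - q w) / h w) ` {lo..hi})"
    by (intro bounded_imp_bdd_above compact_imp_bounded compact_continuous_image) auto
  then have "(p w - q w) / h w \<le> \<epsilon>"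
    using cSUP_upper[OF w] assms(5) unfolding max_rel_diff_def by (meson order_trans)
  then show ?thesis
    using pos[OF w] by (simp add: field_simps)
qed

text \<open>Convexity gives the lower bound without any error term; the relative error enters only
  the upper one. For \<open>g_nest\<close> the two sides are exchanged by concavity.\<close>

lemma pwa_f_nest_bounds:
  assumes "is_partition lo hi K c" and "is_pwa_interpolant (f_nest P n) K c p"
    and "0 < lo" "lo < hi" and "dissim P n \<in> {0..1}"
    and "max_rel_diff lo hi p (f_nest P n) (f_nest P n) \<le> \<epsilon>" and w: "w \<in> {lo..hi}"
  shows "f_nest P n w \<le> p w" and "p w \<le> (1 + \<epsilon>) * f_nest P n w"
proof -
  have "convex_on {lo..hi} (f_nest P n)"
    unfolding f_nest_def using assms(3,5)
    by (intro convex_on_subset[OF powr_convex_nonpos]) auto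
  then show "f_nest P n w \<le> p w"
    using convex_le_pwa_interpolant assms by blast
  have "continuous_on {lo..hi} (f_nest P n)"
    unfolding f_nest_def using assms(3) by (intro continuous_intros) auto
  moreover have "continuous_on {lo..hi} p"
    using assms(1,2) by (auto simp: is_pwa_interpolant_def is_partition_def)
  ultimately have "p w - f_nest P n w \<le> \<epsilon> * f_nest P n w"
    using assms(3) by (intro max_rel_diff_bound[OF _ _ _ _ assms(6) w]) (auto simp: f_nest_def)
  then show "p w \<le> (1 + \<epsilon>) * f_nest P n w"
    by (simp add: algebra_simps)
qed

lemma pwa_g_nest_bounds:
  assumes "is_partition lo hi K c" and "is_pwa_interpolant (g_nest P n) K c p"
    and "0 < lo" "lo < hi" and "dissim P n \<in> {0..1}"
    and "max_rel_diff lo hi (g_nest P n) p (g_nest P n) \<le> \<epsilon>" and w: "w \<in> {lo..hi}"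
  shows "p w \<le> g_nest P n w" and "(1 - \<epsilon>) * g_nest P n w \<le> p w"
proof -
  have "concave_on {lo..hi} (g_nest P n)"
    unfolding g_nest_def concave_on_def using assms(3,5)
    by (intro convex_on_subset[OF powr_concave[unfolded concave_on_def]]) auto
  then show "p w \<le> g_nest P n w"
    using concave_ge_pwa_interpolant assms by blast
  have "continuous_on {lo..hi} (g_nest P n)"
    unfolding g_nest_def using assms(3) by (intro continuous_intros) auto
  moreover have "continuous_on {lo..hi} p"
    using assms(1,2) by (auto simp: is_pwa_interpolant_def is_partition_def)
  ultimately have "g_nest P n w - p w \<le> \<epsilon> * g_nest P n w"
    using assms(3) by (intro max_rel_diff_bound[OF _ _ _ _ assms(6) w]) (auto simp: g_nest_def)
  then show "(1 - \<epsilon>) * g_nest P n w \<le> p w"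
    by (simp add: algebra_simps)
qed

section \<open>Assortments, and the linear fractional program as a revenue function\<close>

text \<open>Finiteness makes the \<open>Min\<close> and \<open>Max\<close> in
  \<open>weight_min\<close> and \<open>weight_max\<close> genuine bounds. Each assortment is the
  characteristic vector of a set of products.\<close>

lemma finite_assortments: "finite (assortments P)"
proof (rule finite_subset)
  let ?e = "\<lambda>S::'a set. (\<chi> i. if i \<in> S then 1 else 0) :: real ^ 'a"
  show "assortments P \<subseteq> range ?e"
  proof
    fix x assume "x \<in> assortments P"
    then have "x $ i = 0 \<or> x $ i = 1" for i
      by (auto simp: assortments_def)
    then have "x = ?e {i. x $ i = 1}"
      by (auto simp: vec_eq_iff)
    then show "x \<in> range ?e" by blast
  qed
qed simp

lemma nest_weight_bounds:
  assumes "x \<in> assortments P"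
  shows "nest_weight P t n x \<in> {weight_min P t n..weight_max P t n}"
  using assms finite_assortments[of P] by (auto simp: weight_min_def weight_max_def)

text \<open>A common form of the exact and the approximate revenue, so that they can be compared
  term by term. The factors independent of \<open>f\<close> are bracketed as one
  coefficient.\<close>

definition revenue_with ::
    "('m::finite, 'n::finite, 't::finite, 'p::finite) ma_instance \<Rightarrow> ('t \<Rightarrow> 'n \<Rightarrow> real \<Rightarrow> real) \<Rightarrow>
     ('t \<Rightarrow> 'n \<Rightarrow> real \<Rightarrow> real) \<Rightarrow> real ^ 'm \<Rightarrow> real" where
  "revenue_with P f g x =
     (\<Sum>t\<in>UNIV. type_prob P t *
        ((\<Sum>i\<in>UNIV. \<Sum>n\<in>UNIV.
            f t n (nest_weight P t n x) * (alloc P i n * x $ i * revenue P i * pref P t i))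
         / (\<Sum>n\<in>UNIV. g t n (nest_weight P t n x))))"

lemma ma_revenue_eq_revenue_with:
  "ma_revenue P x = revenue_with P (\<lambda>t n. f_nest P n) (\<lambda>t n. g_nest P n) x"
  by (simp add: ma_revenue_def revenue_with_def f_nest_def g_nest_def mult.assoc)

lemma lfp_objective_eq_revenue_with:
  assumes part: "\<And>t n. is_partition (weight_min P t n) (weight_max P t n) (K t n) (c t n)"
    and f: "\<And>t n. is_pwa_interpolant (f_nest P n) (K t n) (c t n) (fhat t n)"
    and g: "\<And>t n. is_pwa_interpolant (g_nest P n) (K t n) (c t n) (ghat t n)"
    and feas: "(x, y, z, s) \<in> lfp_feasible P K c"
  shows "lfp_objective P K c (x, y, z, s) = revenue_with P fhat ghat x"
proof -
  let ?W = "\<lambda>t n. nest_weight P t n x"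
  let ?L = "weight_min P"
  have x01: "x $ i = 0 \<or> x $ i = 1" for i
    using feas by (auto simp: lfp_feasible_def assortments_def)
  have y: "y t n k = 0 \<or> y t n k = 1" and z: "z t n k \<in> {0..1}" and s01: "s t i n k \<in> {0..1}"
    if "k \<in> {1..K t n}" for t i n k
    using feas that by (auto simp: lfp_feasible_def)
  have W: "?L t n + (\<Sum>k\<in>{1..K t n}. (c t n (k + 1) - c t n k) * z t n k) = ?W t n" for t n
    using feas by (auto simp: lfp_feasible_def)
  have yz: "y t n k \<le> z t n k" "z t n (k + 1) \<le> y t n k" if "k \<in> {1..K t n - 1}" for t n k
    using feas that by (auto simp: lfp_feasible_def)
  \<comment> \<open>For binary \<open>x $ i\<close> the linear constraints are exact: at 0 they and
    the box constraint force \<open>s\<close> to 0, at 1 they force it to \<open>z\<close>.\<close>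
  have s: "s t i n k = x $ i * z t n k" if k: "k \<in> {1..K t n}" for t i n k
  proof -
    have "s t i n k \<le> x $ i" "s t i n k \<le> z t n k" "x $ i + z t n k - 1 \<le> s t i n k"
      using feas k by (auto simp: lfp_feasible_def)
    then show ?thesis using x01[of i] s01[OF k, of i] by auto
  qed
  \<comment> \<open>If \<open>y\<close> is 1 it pushes \<open>z t n k\<close> up to 1; if it is 0 it
    pushes the next \<open>z\<close> down to 0.\<close>
  have fill: "z t n k = 1 \<or> z t n (k + 1) = 0" if k: "k \<in> {1..K t n - 1}" for t n k
    using yz[OF k] y[of k t n] z[of k t n] z[of "k + 1" t n] k by fastforce
  have at_min: "p (?L t n) = h (?L t n)" if "is_pwa_interpolant h (K t n) (c t n) p" for t n h p
    using that part[of t n] by (force simp: is_pwa_interpolant_def is_partition_def)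
  \<comment> \<open>Kept generic in \<open>h\<close> and \<open>p\<close>, to serve both the
    numerator with \<open>f_nest\<close> and the denominator with \<open>g_nest\<close>.\<close>
  have sums: "(\<Sum>k\<in>{1..K t n}. slope h (c t n) k * (c t n (k + 1) - c t n k) * z t n k)
      = p (?W t n) - h (?L t n)" if "is_pwa_interpolant h (K t n) (c t n) p" for t n h p
    using pwa_interpolant_filling[OF part that, of "z t n"] z fill W[of t n] at_min[OF that] by simp
  \<comment> \<open>The \<open>lfp_a\<close> terms supply the value at the minimal weight, which the
    increments collected by \<open>lfp_b\<close> leave out.\<close>
  have num: "(\<Sum>i\<in>UNIV. \<Sum>n\<in>UNIV. lfp_a P t i n * x $ i)
      + (\<Sum>i\<in>UNIV. \<Sum>n\<in>UNIV. \<Sum>k\<in>{1..K t n}. lfp_b P c t i n k * s t i n k)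
      = (\<Sum>i\<in>UNIV. \<Sum>n\<in>UNIV. fhat t n (?W t n) * (alloc P i n * x $ i * revenue P i * pref P t i))"
    for t
  proof -
    have "(\<Sum>k\<in>{1..K t n}. lfp_b P c t i n k * s t i n k)
        = (fhat t n (?W t n) - f_nest P n (?L t n)) * (alloc P i n * x $ i * revenue P i * pref P t i)"
      for i n
      unfolding sums[OF f, symmetric] sum_distrib_right
      by (intro sum.cong) (simp_all add: lfp_b_def s mult_ac)
    then show ?thesis
      by (simp add: lfp_a_def sum.distrib[symmetric] algebra_simps)
  qed
  have den: "lfp_c P t + (\<Sum>n\<in>UNIV. \<Sum>k\<in>{1..K t n}. lfp_d P c t n k * z t n k)
      = (\<Sum>n\<in>UNIV. ghat t n (?W t n))" for t
  proof -
    have "(\<Sum>k\<in>{1..K t n}. lfp_d P c t n k * z t n k) = ghat t n (?W t n) - g_nest P n (?L t n)" for n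
      unfolding sums[OF g, symmetric] lfp_d_def by (simp add: mult_ac)
    then show ?thesis
      by (simp add: lfp_c_def sum_subtractf)
  qed
  show ?thesis
    unfolding lfp_objective_def revenue_with_def prod.case num den ..
qed

text \<open>Needed so that the optimal assortment of the exact problem competes in the approximate
  one. The witness pours the nest weight into the pieces from left to right.\<close>

lemma lfp_feasible_extension:
  assumes part: "\<And>t n. is_partition (weight_min P t n) (weight_max P t n) (K t n) (c t n)"
    and x: "x \<in> assortments P"
  obtains y z s where "(x, y, z, s) \<in> lfp_feasible P K c"
proof
  let ?W = "\<lambda>t n. nest_weight P t n x"
  \<comment> \<open>\<open>y\<close> marks the pieces that are completely filled.\<close>
  define y where "y = (\<lambda>t n k. if c t n (k + 1) \<le> ?W t n then 1 else 0 :: real)"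
  \<comment> \<open>The fraction of piece \<open>k\<close> lying below the nest weight, written as a
    difference of minima so that the sum over the pieces telescopes.\<close>
  define z where "z = (\<lambda>t n k. (min (?W t n) (c t n (k + 1)) - min (?W t n) (c t n k))
      / (c t n (k + 1) - c t n k))"
  define s where "s = (\<lambda>t i n k. x $ i * z t n k)"
  have x01: "x $ i = 0 \<or> x $ i = 1" for i
    using x by (auto simp: assortments_def)
  have lt: "c t n k < c t n (k + 1)" if "k \<in> {1..K t n}" for t n k
    using part[of t n] that by (auto simp: is_partition_def)
  have z01: "z t n k \<in> {0..1}" if "k \<in> {1..K t n}" for t n k
    using lt[OF that] by (auto simp: z_def min_def field_simps)
  have W: "?W t n = weight_min P t n + (\<Sum>k\<in>{1..K t n}. (c t n (k + 1) - c t n k) * z t n k)" for t n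
  proof -
    have "(\<Sum>k\<in>{1..K t n}. (c t n (k + 1) - c t n k) * z t n k)
        = (\<Sum>k\<in>{1..K t n}. min (?W t n) (c t n (Suc k)) - min (?W t n) (c t n k))"
      using lt[of _ t n] by (intro sum.cong) (auto simp: z_def)
    also have "\<dots> = min (?W t n) (c t n (K t n + 1)) - min (?W t n) (c t n 1)"
      using sum_Suc_diff[of 1 "K t n" "\<lambda>k. min (?W t n) (c t n k)"] by simp
    finally show ?thesis
      using part[of t n] nest_weight_bounds[OF x, of t n] by (auto simp: is_partition_def)
  qed
  have "y t n (k + 1) \<le> y t n k \<and> y t n k \<le> z t n k \<and> z t n (k + 1) \<le> y t n k"
    if "k \<in> {1..K t n - 1}" for t n k
  proof -
    have "c t n k < c t n (k + 1)" "c t n (k + 1) < c t n (k + 1 + 1)"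
      using lt[of k t n] lt[of "k + 1" t n] that by auto
    then show ?thesis
      using z01[of k t n] z01[of "k + 1" t n] that by (auto simp: y_def z_def min_def)
  qed
  moreover have "s t i n k \<in> {0..1} \<and> s t i n k \<le> x $ i \<and> s t i n k \<le> z t n k
      \<and> x $ i + z t n k - 1 \<le> s t i n k" if "k \<in> {1..K t n}" for t i n k
    using x01[of i] z01[OF that] by (auto simp: s_def)
  ultimately show "(x, y, z, s) \<in> lfp_feasible P K c"
    using x W z01 by (auto simp: lfp_feasible_def y_def)
qed

section \<open>Comparison of revenues and the approximation guarantee\<close>

text \<open>Bounding numerators by the factor \<open>a\<close> and denominators by \<open>b\<close>
  bounds each quotient by \<open>a / b\<close>, and nonnegative type probabilities preserve this.
  Both directions between exact and approximate revenue are instances.\<close>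

lemma revenue_with_mono:
  assumes \<theta>: "\<And>t. type_prob P t \<ge> 0" and "\<And>i. revenue P i \<ge> 0" and "\<And>t i. pref P t i \<ge> 0"
    and "\<And>i n. alloc P i n \<ge> 0" and x: "\<And>i. x $ i \<ge> 0"
    and f: "\<And>t n. 0 \<le> f t n (nest_weight P t n x)"
      "\<And>t n. f t n (nest_weight P t n x) \<le> a * f' t n (nest_weight P t n x)"
    and g: "\<And>t n. 0 < g' t n (nest_weight P t n x)"
      "\<And>t n. b * g' t n (nest_weight P t n x) \<le> g t n (nest_weight P t n x)"
    and b: "0 < b"
  shows "revenue_with P f g x \<le> a / b * revenue_with P f' g' x"
proof -
  let ?num = "\<lambda>f t. \<Sum>i\<in>UNIV. \<Sum>n\<in>UNIV.
      f t n (nest_weight P t n x) * (alloc P i n * x $ i * revenue P i * pref P t i)"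
  let ?den = "\<lambda>g t. \<Sum>n\<in>UNIV. g t n (nest_weight P t n x)"
  have coeff: "0 \<le> alloc P i n * x $ i * revenue P i * pref P t i" for t i n
    using assms(2-4) x by simp
  have "?num f t / ?den g t \<le> a / b * (?num f' t / ?den g' t)" for t
  proof -
    have "0 \<le> ?num f t"
      by (intro sum_nonneg mult_nonneg_nonneg[OF f(1) coeff])
    moreover have "?num f t \<le> a * ?num f' t"
      unfolding sum_distrib_left mult.assoc[symmetric, of a]
      using f(2) coeff by (intro sum_mono mult_right_mono)
    moreover have "0 < ?den g' t"
      using g(1) by (intro sum_pos) auto
    moreover have "b * ?den g' t \<le> ?den g t"
      unfolding sum_distrib_left using g(2) by (rule sum_mono)
    \<comment> \<open>The numerators are nonnegative, so passing to the smaller positive denominator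
      \<open>b * ?den g' t\<close> cannot decrease the quotient.\<close>
    ultimately have "?num f t / ?den g t \<le> (a * ?num f' t) / (b * ?den g' t)"
      using b by (intro frac_le) auto
    then show ?thesis by simp
  qed
  then have "type_prob P t * (?num f t / ?den g t) \<le> a / b * (type_prob P t * (?num f' t / ?den g' t))"
    for t
    using mult_left_mono[OF _ \<theta>[of t]] by (metis (no_types, lifting) mult.left_commute)
  then show ?thesis
    unfolding revenue_with_def sum_distrib_left by (rule sum_mono)
qed


theorem corollary4:
  fixes P :: "('m::finite, 'n::finite, 't::finite, 'p::finite) ma_instance"
    and K :: "'t \<Rightarrow> 'n \<Rightarrow> nat"
    and c :: "'t \<Rightarrow> 'n \<Rightarrow> nat \<Rightarrow> real"
    and fhat ghat :: "'t \<Rightarrow> 'n \<Rightarrow> real \<Rightarrow> real"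
    and \<epsilon> :: real
    and xstar xhat :: "real ^ 'm"
    and yhat zhat :: "'t \<Rightarrow> 'n \<Rightarrow> nat \<Rightarrow> real"
    and shat :: "'t \<Rightarrow> 'm \<Rightarrow> 'n \<Rightarrow> nat \<Rightarrow> real"
  assumes "\<And>t. type_prob P t \<ge> 0" and "(\<Sum>t\<in>UNIV. type_prob P t) = 1"
    and "\<And>i. revenue P i \<ge> 0"
    and "\<And>t i. pref P t i \<ge> 0"
    and "\<And>i n. alloc P i n \<ge> 0" and "\<And>i. (\<Sum>n\<in>UNIV. alloc P i n) = 1"
    and "\<And>n. nopurchase P n \<ge> 0"
    and "\<And>n. dissim P n \<in> {0..1}"
    and "assortments P \<noteq> {}"
    and "\<And>t n. 0 < weight_min P t n" and "\<And>t n. weight_min P t n < weight_max P t n"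
    and "\<And>t n. is_partition (weight_min P t n) (weight_max P t n) (K t n) (c t n)"
    and "\<And>t n. is_pwa_interpolant (f_nest P n) (K t n) (c t n) (fhat t n)"
    and "\<And>t n. is_pwa_interpolant (g_nest P n) (K t n) (c t n) (ghat t n)"
    and "0 < \<epsilon>" and "\<epsilon> < 1"
    and "\<And>t n. max_rel_diff (weight_min P t n) (weight_max P t n) (fhat t n) (f_nest P n) (f_nest P n) \<le> \<epsilon>"
    and "\<And>t n. max_rel_diff (weight_min P t n) (weight_max P t n) (g_nest P n) (ghat t n) (g_nest P n) \<le> \<epsilon>"
    and "is_arg_max (ma_revenue P) (\<lambda>x. x \<in> assortments P) xstar"
    and "is_arg_max (lfp_objective P K c) (\<lambda>p. p \<in> lfp_feasible P K c) (xhat, yhat, zhat, shat)"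
  shows "(1 - \<epsilon>) / (1 + \<epsilon>) * ma_revenue P xstar \<le> ma_revenue P xhat
         \<and> ma_revenue P xhat \<le> ma_revenue P xstar"
proof
  note feasible = assms(19,20)[unfolded is_arg_max_linorder]
  have xhat: "xhat \<in> assortments P"
    using feasible(2) by (auto simp: lfp_feasible_def)
  then show "ma_revenue P xhat \<le> ma_revenue P xstar"
    using feasible(1) by auto
  let ?Fhat = "revenue_with P fhat ghat"
  note objective = lfp_objective_eq_revenue_with[OF assms(12-14)]
  have bounds: "ma_revenue P x \<le> ?Fhat x" "?Fhat x \<le> (1 + \<epsilon>) / (1 - \<epsilon>) * ma_revenue P x"
    if x: "x \<in> assortments P" for x
  proof -
    let ?W = "\<lambda>t n. nest_weight P t n x"
    note f = pwa_f_nest_bounds[OF assms(12,13,10,11,8,17) nest_weight_bounds[OF x]]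
    note g = pwa_g_nest_bounds[OF assms(12,14,10,11,8,18) nest_weight_bounds[OF x]]
    have W: "0 < ?W t n" for t n
      using nest_weight_bounds[OF x, of t n] assms(10)[of t n] by simp
    have fpos: "0 < f_nest P n (?W t n)" and gpos: "0 < g_nest P n (?W t n)" for t n
      using W[of t n] by (auto simp: f_nest_def g_nest_def)
    have fhat_pos: "0 < fhat t n (?W t n)" for t n
      using fpos f(1) by (rule less_le_trans)
    \<comment> \<open>Here \<open>\<epsilon> < 1\<close> matters: it keeps the lower bound
      \<open>(1 - \<epsilon>) * g_nest\<close> positive.\<close>
    have ghat_pos: "0 < ghat t n (?W t n)" for t n
      by (rule less_le_trans[OF _ g(2)]) (use gpos \<open>\<epsilon> < 1\<close> in simp)
    have x0: "0 \<le> x $ i" for i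
    proof -
      have "x $ i \<in> {0, 1}"
        using x by (simp add: assortments_def)
      then show ?thesis by auto
    qed
    note mono = revenue_with_mono[where P = P and x = x, OF assms(1,3,4,5) x0]
    \<comment> \<open>The trivial quotient matches the \<open>a / b\<close> of
      \<open>revenue_with_mono\<close>: the interpolants err in the direction that only raises the
      revenue, so both factors are 1.\<close>
    have "ma_revenue P x \<le> 1 / 1 * ?Fhat x"
      unfolding ma_revenue_eq_revenue_with
      by (rule mono) (simp_all add: less_imp_le[OF fpos] f(1) ghat_pos g(1))
    then show "ma_revenue P x \<le> ?Fhat x" by simp
    show "?Fhat x \<le> (1 + \<epsilon>) / (1 - \<epsilon>) * ma_revenue P x"
      unfolding ma_revenue_eq_revenue_with
      by (rule mono) (simp_all add: less_imp_le[OF fhat_pos] f(2) gpos g(2) \<open>\<epsilon> < 1\<close>)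
  qed
  have xstar: "xstar \<in> assortments P"
    using feasible(1) by auto
  obtain y z s where yzs: "(xstar, y, z, s) \<in> lfp_feasible P K c"
    using lfp_feasible_extension[OF assms(12) xstar] by blast
  have "ma_revenue P xstar \<le> ?Fhat xstar"
    using bounds(1)[OF xstar] .
  \<comment> \<open>Optimality of the given point against the extension of \<open>xstar\<close>,
    both objectives being read as \<open>?Fhat\<close>.\<close>
  also have "\<dots> \<le> ?Fhat xhat"
    using feasible(2) yzs unfolding objective[OF yzs, symmetric]
    by (simp add: objective[of xhat yhat zhat shat, symmetric])
  also have "\<dots> \<le> (1 + \<epsilon>) / (1 - \<epsilon>) * ma_revenue P xhat"
    using bounds(2)[OF xhat] .
  finally show "(1 - \<epsilon>) / (1 + \<epsilon>) * ma_revenue P xstar \<le> ma_revenue P xhat"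
    using \<open>0 < \<epsilon>\<close> \<open>\<epsilon> < 1\<close> by (simp add: field_simps)
qed

end
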